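(* Let $b\ge 2$ be an integer, let $\alpha,\lambda>0$, and let $A\subset\mathbb{R}$, $A\notin\{\emptyset,\mathbb{R}\}$, be a finite union of $r_A\ge1$ pairwise disjoint intervals with endpoints $-\infty\le a_j<b_j\le\infty$. Let $\nu$ be the standard Gaussian measure on $\mathbb{R}$ and $g_A(x)=\nu(A-x)$, $x\in\mathbb{R}$. If every local maximizer of $g_A$ on $\mathbb{R}$ is a global maximizer of $g_A$, then $$Q_A(q+)=Q_A(q)\qquad\text{for every }q\in(\nu(A),M_A),$$ where $M_A$, $Q_A$ and $Q_A(q+)$ are as in the context.
   Context: $A-x=\{a-x:a\in A\}$; $M_A=\sup_{x\in\mathbb{R}}g_A(x)$. $\mathbb{T}_b=\bigcup_{k\ge0}\{1,\dots,b\}^k$ is the rooted $b$-ary tree with root $\varnothing$; $|v|$ is the length of $v$. $\mathcal{H}_b$ is the set of real fields $h=(h_v)_{v\in\mathbb{T}_b}$ with $h_\varnothing=0$ and $\|h\|_b:=\sum_{k\ge1}b^{-k}\sum_{|v|=k}|h_v|<\infty$. $\partial\mathbb{T}_b=\{1,\dots,b\}^{\{1,2,\dots\}}$ carries the product $\sigma$-algebra and the product measure $\mathbf{m}_b$ of uniform measures on $\{1,\dots,b\}$; $\xi|k$ is the vector of the first $k$ coordinates of $\xi$. For $h\in\mathcal{H}_b$, $H_h(\xi)=\sum_{k\ge1}h_{\xi|k}$ (absolutely convergent for $\mathbf{m}_b$-a.e. $\xi$), $\Psi_A(h)=\int_{\partial\mathbb{T}_b}g_A(H_h(\xi))\,\mathbf{m}_b(d\xi)$,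 $\mathcal{I}_\alpha(h)=\lambda\sum_{v\ne\varnothing}|h_v|^\alpha\in[0,\infty]$, and $Q_A(q)=\inf\{\mathcal{I}_\alpha(h):h\in\mathcal{H}_b,\ \Psi_A(h)=q\}$ for $q\in[0,1]$, with $\inf\emptyset=\infty$. $Q_A$ is strictly increasing on $[\nu(A),M_A)$, and for $q\in(\nu(A),M_A)$, $Q_A(q+):=\lim_{q'\downarrow q}Q_A(q')$. *)

theory Defs
  imports "HOL-Probability.Probability"
begin

definition gauss :: "real measure" where
  "gauss = density lborel std_normal_density"

definition gA :: "real set \<Rightarrow> real \<Rightarrow> real" where
  "gA A x = measure gauss ((\<lambda>a. a - x) ` A)"

definition MA :: "real set \<Rightarrow> real" where
  "MA A = (SUP x. gA A x)"

definition local_maximizer :: "(real \<Rightarrow> real) \<Rightarrow> real \<Rightarrow> bool" where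
  "local_maximizer f x \<longleftrightarrow> (\<forall>\<^sub>F y in nhds x. f y \<le> f x)"

definition global_maximizer :: "(real \<Rightarrow> real) \<Rightarrow> real \<Rightarrow> bool" where
  "global_maximizer f x \<longleftrightarrow> (\<forall>y. f y \<le> f x)"

(* Open, closed and half-open intervals are all allowed: the two inclusions fix J
   up to membership of the (finite) endpoints. *)
definition interval_with_endpoints :: "ereal \<Rightarrow> ereal \<Rightarrow> real set \<Rightarrow> bool" where
  "interval_with_endpoints l u J \<longleftrightarrow>
     l < u \<and> {x. l < ereal x \<and> ereal x < u} \<subseteq> J \<and> J \<subseteq> {x. l \<le> ereal x \<and> ereal x \<le> u}"

definition disjoint_interval_union :: "nat \<Rightarrow> real set \<Rightarrow> bool" where
  "disjoint_interval_union r A \<longleftrightarrow>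
     (\<exists>(l :: nat \<Rightarrow> ereal) (u :: nat \<Rightarrow> ereal) (J :: nat \<Rightarrow> real set).
        (\<forall>j<r. interval_with_endpoints (l j) (u j) (J j)) \<and>
        disjoint_family_on J {..<r} \<and> A = (\<Union>j<r. J j))"

(* The root is the empty list. *)
definition tree :: "nat \<Rightarrow> nat list set" where
  "tree b = lists {1..b}"

definition level :: "nat \<Rightarrow> nat \<Rightarrow> nat list set" where
  "level b k = {v \<in> tree b. length v = k}"

(* Fields are total functions on lists; their values outside the tree are
   unconstrained and do not enter any of the quantities below.
   Series over k \<ge> 1 are indexed by Suc k throughout. *)
definition fields :: "nat \<Rightarrow> (nat list \<Rightarrow> real) set" where
  "fields b = {h. h [] = 0 \<and>
     summable (\<lambda>k. (\<Sum>v\<in>level b (Suc k). \<bar>h v\<bar>) / real b ^ Suc k)}"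

definition boundary :: "nat \<Rightarrow> (nat \<Rightarrow> nat) measure" where
  "boundary b = PiM {1..} (\<lambda>_. uniform_count_measure {1..b})"

definition prefix_vertex :: "(nat \<Rightarrow> nat) \<Rightarrow> nat \<Rightarrow> nat list" where
  "prefix_vertex \<xi> k = map \<xi> [1..<Suc k]"

(* For h in fields b the series converges absolutely almost everywhere; on the
   exceptional null set suminf has an arbitrary value. *)
definition branch_sum :: "(nat list \<Rightarrow> real) \<Rightarrow> (nat \<Rightarrow> nat) \<Rightarrow> real" where
  "branch_sum h \<xi> = (\<Sum>k. h (prefix_vertex \<xi> (Suc k)))"

definition PsiA :: "nat \<Rightarrow> real set \<Rightarrow> (nat list \<Rightarrow> real) \<Rightarrow> real" where
  "PsiA b A h = (\<integral>\<xi>. gA A (branch_sum h \<xi>) \<partial>boundary b)"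

definition cost :: "nat \<Rightarrow> real \<Rightarrow> real \<Rightarrow> (nat list \<Rightarrow> real) \<Rightarrow> ennreal" where
  "cost b \<alpha> lam h =
     ennreal lam * (\<Sum>\<^sub>\<infinity>v\<in>tree b - {[]}. ennreal (\<bar>h v\<bar> powr \<alpha>))"

definition QA :: "nat \<Rightarrow> real \<Rightarrow> real \<Rightarrow> real set \<Rightarrow> real \<Rightarrow> ennreal" where
  "QA b \<alpha> lam A q = Inf {cost b \<alpha> lam h | h. h \<in> fields b \<and> PsiA b A h = q}"

end

theory Submission
  imports Defs
begin

text \<open>Scaling a field by \<open>t \<in> [0, 1]\<close> does not increase its cost and moves \<open>\<Psi>\<close> continuously from
  \<open>\<nu>(A)\<close> to \<open>\<Psi>(h)\<close>, so \<open>Q\<close> is monotone and it remains to improve any \<open>h\<close> with \<open>\<Psi>(h) < M\<close> at an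
  arbitrarily small extra cost. If no small change \<open>s\<close> of the value of \<open>h\<close> at a single vertex \<open>v\<close>
  increases \<open>\<Psi>\<close>, then \<open>g(H + s) - g(H)\<close> has nonpositive integral over the cylinder of \<open>v\<close>. The
  admissible size of \<open>s\<close> does not depend on \<open>v\<close>, so letting the cylinders shrink gives
  \<open>g(H + s) \<le> g(H)\<close> almost everywhere for every small \<open>s\<close>. Hence almost every \<open>H(\<xi>)\<close> is a local, and by
  hypothesis a global, maximizer of \<open>g\<close>, which forces \<open>\<Psi>(h) = M\<close>.\<close>

section \<open>Gaussian measure of translates\<close>

text \<open>The open interval lies in the interior of \<open>J\<close> and the closed one contains
  its closure, so a frontier point is an endpoint. \<open>real_of_ereal\<close> sends an infinite
  endpoint to 0, which merely enlarges the bounding set.\<close>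

lemma frontier_interval_with_endpoints:
  assumes "interval_with_endpoints l u J"
  shows "frontier J \<subseteq> {real_of_ereal l, real_of_ereal u}"
proof -
  have J: "{x. l < ereal x \<and> ereal x < u} \<subseteq> J" "J \<subseteq> {x. l \<le> ereal x \<and> ereal x \<le> u}"
    using assms by (auto simp: interval_with_endpoints_def)
  have "open {x. l < ereal x \<and> ereal x < u}"
    by (intro open_Collect_conj open_Collect_less continuous_intros continuous_on_ereal)
  then have int: "{x. l < ereal x \<and> ereal x < u} \<subseteq> interior J"
    using J(1) by (simp add: interior_maximal)
  have "closed {x. l \<le> ereal x \<and> ereal x \<le> u}"
    by (intro closed_Collect_conj closed_Collect_le continuous_intros continuous_on_ereal)
  then have cl: "closure J \<subseteq> {x. l \<le> ereal x \<and> ereal x \<le> u}"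
    using J(2) by (simp add: closure_minimal)
  show ?thesis
  proof
    fix x assume "x \<in> frontier J"
    then have "ereal x = l \<or> ereal x = u"
      using int cl by (auto simp: frontier_def order.order_iff_strict)
    then show "x \<in> {real_of_ereal l, real_of_ereal u}" by auto
  qed
qed

text \<open>The shape of \<open>A\<close> enters the later lemmas in this form: a finite frontier
  makes \<open>A\<close> Borel and \<open>gA A\<close> continuous.\<close>

lemma finite_frontier_disjoint_interval_union:
  assumes "disjoint_interval_union r A"
  shows "finite (frontier A)"
proof -
  obtain l u J where J: "\<forall>j<r. interval_with_endpoints (l j) (u j) (J j)" "A = (\<Union>j<r. J j)"
    using assms by (auto simp: disjoint_interval_union_def)
  have "frontier A \<subseteq> (\<Union>t\<in>J ` {..<r}. frontier t)"
    using frontier_Union_subset[of "J ` {..<r}"] J(2) by simp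
  moreover have "finite (frontier t)" if "t \<in> J ` {..<r}" for t
  proof -
    from \<open>t \<in> J ` {..<r}\<close> obtain j where "j < r" "t = J j" by auto
    then have "frontier t \<subseteq> {real_of_ereal (l j), real_of_ereal (u j)}"
      using J(1) frontier_interval_with_endpoints by simp
    then show ?thesis by (rule finite_subset) simp
  qed
  ultimately show ?thesis by (meson finite_UN_I finite_imageI finite_lessThan finite_subset)
qed

lemma borel_if_finite_frontier:
  fixes A :: "real set"
  assumes "finite (frontier A)"
  shows "A \<in> sets borel"
proof -
  have "A = interior A \<union> (A \<inter> frontier A)"
    using interior_subset closure_subset by (auto simp: frontier_def)
  moreover have "A \<inter> frontier A \<in> sets borel"
    using assms by (intro borel_closed finite_imp_closed) auto
  ultimately show ?thesis by (metis borel_open open_interior sets.Un)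
qed

lemma prob_space_gauss: "prob_space gauss"
  unfolding gauss_def by (rule prob_space_normal_density) simp

lemma sets_gauss [measurable_cong, simp]: "sets gauss = sets borel"
  and space_gauss [simp]: "space gauss = UNIV"
  by (simp_all add: gauss_def)

lemma gA_bounds: "0 \<le> gA A x" "gA A x \<le> 1"
  using prob_space.prob_le_1[OF prob_space_gauss] by (auto simp: gA_def)

lemma gA_0: "gA A 0 = measure gauss A"
  by (simp add: gA_def)

text \<open>Writing the translate as a preimage moves \<open>x\<close> from the set into the
  integrand, where dominated convergence can act.\<close>

lemma gA_eq_integral:
  assumes "A \<in> sets borel"
  shows "gA A x = (\<integral>y. indicator A (y + x) \<partial>gauss)"
proof -
  have "(\<lambda>a. a - x) ` A = (\<lambda>y. y + x) -` A"
    by (auto simp: image_iff) (metis add_diff_cancel_right')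
  then have "gA A x = (\<integral>y. indicator ((\<lambda>y. y + x) -` A) y \<partial>gauss)"
    by (simp add: gA_def)
  then show ?thesis by (simp add: indicator_def)
qed

text \<open>The indicator of \<open>A\<close> is continuous at \<open>y + x\<close> unless
  \<open>y + x\<close> is a frontier point. This excludes only finitely many \<open>y\<close>, hence
  a Gaussian null set, and dominated convergence with the constant 1 applies.\<close>

lemma isCont_gA:
  assumes fin: "finite (frontier A)"
  shows "isCont (gA A) x"
proof -
  note [measurable] = borel_if_finite_frontier[OF fin]
  have null: "AE y in gauss. y + x \<notin> frontier A"
  proof -
    have "(\<lambda>z. z - x) ` frontier A \<in> null_sets lborel"
      using fin by (intro finite_imp_null_set_lborel) auto
    from AE_not_in[OF this] have "AE y in lborel. y + x \<notin> frontier A"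
      by eventually_elim (auto simp: image_iff)
    then show ?thesis
      unfolding gauss_def by (subst AE_density) auto
  qed
  have "(\<lambda>n. gA A (X n)) \<longlonglongrightarrow> gA A x" if X: "X \<longlonglongrightarrow> x" for X
    unfolding gA_eq_integral[OF borel_if_finite_frontier[OF fin]]
  proof (rule integral_dominated_convergence[where w="\<lambda>_. 1"])
    interpret prob_space gauss by (rule prob_space_gauss)
    show "integrable gauss (\<lambda>_. 1 :: real)" by simp
    show "AE y in gauss. (\<lambda>n. indicator A (y + X n) :: real) \<longlonglongrightarrow> indicator A (y + x)"
      using null
    proof eventually_elim
      case (elim y)
      have "isCont (indicator A :: real \<Rightarrow> real) (y + x)"
        using elim by (simp add: isCont_indicator)
      moreover have "(\<lambda>n. y + X n) \<longlonglongrightarrow> y + x"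
        by (intro tendsto_intros X)
      ultimately show ?case by (rule isCont_tendsto_compose)
    qed
  qed (auto simp: indicator_def)
  then show ?thesis
    by (auto simp: continuous_at_sequentially o_def)
qed

section \<open>Approximation by an algebra\<close>

text \<open>The approximable sets contain the algebra and are closed under complements, which
  preserve symmetric differences, and under countable unions. Induction over
  \<open>sigma_sets\<close> then reaches every measurable set.\<close>

lemma (in finite_measure) approximation_by_algebra:
  assumes alg: "algebra (space M) \<A>" and gen: "sets M = sigma_sets (space M) \<A>"
    and "E \<in> sets M" "\<epsilon> > 0"
  shows "\<exists>C\<in>\<A>. measure M ((E - C) \<union> (C - E)) < \<epsilon>"
proof -
  interpret A: algebra "space M" \<A> by (rule alg)
  have [measurable]: "C \<in> sets M" if "C \<in> \<A>" for C
    using that gen by auto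
  define P where "P E \<longleftrightarrow> E \<in> sets M \<and>
    (\<forall>\<epsilon>>0. \<exists>C\<in>\<A>. measure M ((E - C) \<union> (C - E)) < \<epsilon>)" for E
  \<comment> \<open>The symmetric difference of two unions lies in the union of the symmetric
    differences, so two errors below \<epsilon>/2 suffice.\<close>
  have P_Un: "P (E \<union> F)" if E: "P E" and F: "P F" for E F
    unfolding P_def
  proof (intro conjI allI impI)
    have [measurable]: "E \<in> sets M" "F \<in> sets M" using E F by (auto simp: P_def)
    show "E \<union> F \<in> sets M" by simp
    fix \<epsilon> :: real assume "\<epsilon> > 0"
    then obtain C D where C: "C \<in> \<A>" "measure M ((E - C) \<union> (C - E)) < \<epsilon>/2"
      and D: "D \<in> \<A>" "measure M ((F - D) \<union> (D - F)) < \<epsilon>/2"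
      using E F unfolding P_def by (meson half_gt_zero)
    note [measurable] = C(1)[THEN \<open>\<And>C. C \<in> \<A> \<Longrightarrow> C \<in> sets M\<close>] D(1)[THEN \<open>\<And>C. C \<in> \<A> \<Longrightarrow> C \<in> sets M\<close>]
    have "measure M ((E \<union> F - (C \<union> D)) \<union> (C \<union> D - (E \<union> F)))
        \<le> measure M (((E - C) \<union> (C - E)) \<union> ((F - D) \<union> (D - F)))"
      by (intro finite_measure_mono) (auto simp: sets.Un sets.Diff)
    also have "\<dots> \<le> measure M ((E - C) \<union> (C - E)) + measure M ((F - D) \<union> (D - F))"
      by (intro measure_Un_le) auto
    also have "\<dots> < \<epsilon>" using C D by simp
    finally show "\<exists>C\<in>\<A>. measure M ((E \<union> F - C) \<union> (C - (E \<union> F))) < \<epsilon>"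
      using C D by (intro bexI[of _ "C \<union> D"]) auto
  qed
  have "P E" if "E \<in> sigma_sets (space M) \<A>" for E
    using that
  proof induction
    case (Basic a)
    then show ?case by (auto simp: P_def gen intro!: bexI[of _ a])
  next
    case Empty
    show ?case by (auto simp: P_def intro!: bexI[of _ "{}"])
  next
    case (Compl a)
    show ?case unfolding P_def
    proof (intro conjI allI impI)
      show "space M - a \<in> sets M" using Compl by (auto simp: P_def)
      fix \<epsilon> :: real assume "\<epsilon> > 0"
      then obtain C where C: "C \<in> \<A>" "measure M ((a - C) \<union> (C - a)) < \<epsilon>"
        using Compl unfolding P_def by meson
      have "a \<subseteq> space M" "C \<subseteq> space M"
        using Compl C A.space_closed by (auto simp: P_def dest: sets.sets_into_space)
      then have "(space M - a - (space M - C)) \<union> (space M - C - (space M - a)) = (a - C) \<union> (C - a)"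
        by auto
      then show "\<exists>C\<in>\<A>. measure M ((space M - a - C) \<union> (C - (space M - a))) < \<epsilon>"
        using C by (intro bexI[of _ "space M - C"]) auto
    qed
  next
    case (Union a)
    \<comment> \<open>By continuity from below a finite partial union misses less than \<epsilon>/2
      of the whole; the remaining \<epsilon>/2 is spent on approximating that partial union.\<close>
    define U where "U n = (\<Union>i\<le>n. a i)" for n :: nat
    have PU: "P (U n)" for n
    proof (induction n)
      case (Suc n)
      have "U (Suc n) = U n \<union> a (Suc n)" by (auto simp: U_def atMost_Suc)
      with Suc Union show ?case by (simp add: P_Un)
    qed (use Union in \<open>simp add: U_def\<close>)
    have U_sets[measurable]: "U n \<in> sets M" for n using PU by (simp add: P_def)
    have UN: "(\<Union>i. U i) = (\<Union>i. a i)" by (auto simp: U_def)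
    have "incseq U" unfolding U_def by (force simp: incseq_def)
    then have lim: "(\<lambda>n. measure M (U n)) \<longlonglongrightarrow> measure M (\<Union>i. a i)"
      using finite_Lim_measure_incseq[of U] UN by (auto simp: image_subset_iff)
    have [measurable]: "(\<Union>i. a i) \<in> sets M" unfolding UN[symmetric] by auto
    show ?case unfolding P_def
    proof (intro conjI allI impI)
      show "(\<Union>i. a i) \<in> sets M" by simp
      fix \<epsilon> :: real assume "\<epsilon> > 0"
      then have "\<forall>\<^sub>F n in sequentially. measure M (\<Union>i. a i) - \<epsilon>/2 < measure M (U n)"
        by (intro order_tendstoD(1)[OF lim]) simp
      then obtain n where n: "measure M (\<Union>i. a i) - \<epsilon>/2 < measure M (U n)"
        by (auto simp: eventually_sequentially)
      obtain C where C: "C \<in> \<A>" "measure M ((U n - C) \<union> (C - U n)) < \<epsilon>/2"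
        using PU[of n] \<open>\<epsilon> > 0\<close> unfolding P_def by (meson half_gt_zero)
      note [measurable] = C(1)[THEN \<open>\<And>C. C \<in> \<A> \<Longrightarrow> C \<in> sets M\<close>]
      have sub: "U n \<subseteq> (\<Union>i. a i)" by (auto simp: U_def)
      have "measure M (((\<Union>i. a i) - C) \<union> (C - (\<Union>i. a i)))
          \<le> measure M (((\<Union>i. a i) - U n) \<union> ((U n - C) \<union> (C - U n)))"
        using sub by (intro finite_measure_mono) auto
      also have "\<dots> \<le> measure M ((\<Union>i. a i) - U n) + measure M ((U n - C) \<union> (C - U n))"
        by (intro measure_Un_le) auto
      also have "measure M ((\<Union>i. a i) - U n) = measure M (\<Union>i. a i) - measure M (U n)"
        using sub by (intro finite_measure_Diff) auto
      finally have "measure M (((\<Union>i. a i) - C) \<union> (C - (\<Union>i. a i))) < \<epsilon>"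
        using n C by simp
      then show "\<exists>C\<in>\<A>. measure M (((\<Union>i. a i) - C) \<union> (C - (\<Union>i. a i))) < \<epsilon>"
        using C by blast
    qed
  qed
  then show ?thesis using assms by (simp add: P_def)
qed

text \<open>Approximating \<open>E = {f > 0}\<close> by a member of the algebra changes the integral
  of \<open>f\<close> by at most \<open>B\<close> times the measure of the symmetric difference. So
  the integral over \<open>E\<close> is nonpositive although its integrand is nonnegative, and
  \<open>E\<close> is null.\<close>

lemma (in finite_measure) AE_nonpos_if_integrals_over_algebra_nonpos:
  fixes f :: "'a \<Rightarrow> real"
  assumes alg: "algebra (space M) \<A>" and gen: "sets M = sigma_sets (space M) \<A>"
    and [measurable]: "f \<in> borel_measurable M" and bd: "\<And>x. \<bar>f x\<bar> \<le> B"
    and nonpos: "\<And>C. C \<in> \<A> \<Longrightarrow> (\<integral>x. indicator C x * f x \<partial>M) \<le> 0"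
  shows "AE x in M. f x \<le> 0"
proof -
  define E where "E = {x \<in> space M. f x > 0}"
  have [measurable]: "E \<in> sets M" by (simp add: E_def)
  have int: "integrable M (\<lambda>x. indicator S x * f x)" if [measurable]: "S \<in> sets M" for S
    using bd by (intro integrable_const_bound[of _ B]) (auto simp: indicator_def intro: order_trans[OF abs_ge_zero])
  have B: "B \<ge> 0" using bd abs_ge_zero order_trans by blast
  have "(\<integral>x. indicator E x * f x \<partial>M) \<le> 0 + \<epsilon>" if eps: "\<epsilon> > 0" for \<epsilon>
  proof -
    \<comment> \<open>Dividing by \<open>B + 1\<close> rather than \<open>B\<close> covers the case
      \<open>B = 0\<close>.\<close>
    obtain C where C: "C \<in> \<A>" "measure M ((E - C) \<union> (C - E)) < \<epsilon> / (B + 1)"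
      using approximation_by_algebra[OF alg gen \<open>E \<in> sets M\<close>, of "\<epsilon> / (B + 1)"] eps B
      by (meson add_nonneg_pos divide_pos_pos zero_less_one)
    have [measurable]: "C \<in> sets M" using C gen by auto
    have "(\<integral>x. indicator E x * f x \<partial>M)
        \<le> (\<integral>x. indicator C x * f x + indicator ((E - C) \<union> (C - E)) x * B \<partial>M)"
    proof (intro integral_mono int Bochner_Integration.integrable_add)
      show "integrable M (\<lambda>x. indicator ((E - C) \<union> (C - E)) x * B)"
        by (intro integrable_mult_left integrable_real_indicator) (auto simp: less_top[symmetric])
      show "indicator E x * f x \<le> indicator C x * f x + indicator (E - C \<union> (C - E)) x * B" for x
        using bd[of x] by (auto simp: indicator_def)
    qed auto
    also have "\<dots> = (\<integral>x. indicator C x * f x \<partial>M) + measure M ((E - C) \<union> (C - E)) * B"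
      by (subst Bochner_Integration.integral_add)
        (auto intro!: int integrable_mult_left integrable_real_indicator simp: less_top[symmetric])
    also have "\<dots> \<le> 0 + \<epsilon> / (B + 1) * B"
      using nonpos[OF C(1)] C(2) B by (intro add_mono mult_right_mono) auto
    also have "\<dots> \<le> 0 + \<epsilon>" using B eps by (simp add: field_simps)
    finally show ?thesis .
  qed
  then have le: "(\<integral>x. indicator E x * f x \<partial>M) \<le> 0" by (rule field_le_epsilon)
  have nn: "0 \<le> indicator E x * f x" for x by (auto simp: indicator_def E_def)
  have "(\<integral>x. indicator E x * f x \<partial>M) = 0"
    using le Bochner_Integration.integral_nonneg[of M "\<lambda>x. indicator E x * f x"] nn by (simp add: antisym)
  then have "AE x in M. indicator E x * f x = 0"
    using integral_nonneg_eq_0_iff_AE[OF int[of E]] nn by auto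
  then show ?thesis
    using AE_space by eventually_elim (auto simp: E_def indicator_def split: if_splits)
qed

section \<open>The boundary of the tree\<close>

lemma finite_level [simp]: "finite (level b k)"
proof -
  have "level b k = {v. set v \<subseteq> {1..b} \<and> length v = k}"
    by (auto simp: level_def tree_def)
  then show ?thesis by (simp add: finite_lists_length_eq)
qed

lemma prob_space_boundary: "b > 0 \<Longrightarrow> prob_space (boundary b)"
  unfolding boundary_def
  by (intro prob_space_PiM prob_space_uniform_count_measure) auto

lemma length_prefix_vertex [simp]: "length (prefix_vertex \<xi> k) = k"
  by (simp add: prefix_vertex_def)

text \<open>Boundary coordinates are numbered from 1 but list positions from 0.\<close>

lemma nth_prefix_vertex: "i < k \<Longrightarrow> prefix_vertex \<xi> k ! i = \<xi> (Suc i)"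
  by (simp add: prefix_vertex_def del: upt_Suc)

lemma take_prefix_vertex: "j \<le> k \<Longrightarrow> take j (prefix_vertex \<xi> k) = prefix_vertex \<xi> j"
  by (simp add: prefix_vertex_def take_map del: upt_Suc)

lemma prefix_vertex_in_level:
  assumes "\<xi> \<in> space (boundary b)"
  shows "prefix_vertex \<xi> k \<in> level b k"
  using assms
  by (auto simp: boundary_def space_PiM space_uniform_count_measure level_def tree_def
      prefix_vertex_def PiE_iff)

lemma coordinate_measurable:
  assumes "i \<ge> 1"
  shows "(\<lambda>\<xi>. \<xi> i) \<in> measurable (boundary b) (count_space UNIV)"
proof -
  have "(\<lambda>\<xi>. \<xi> i) \<in> measurable (boundary b) (uniform_count_measure {1..b})"
    unfolding boundary_def using assms by (intro measurable_component_singleton) auto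
  then have "(\<lambda>\<xi>. \<xi> i) \<in> measurable (boundary b) (count_space {1..b})"
    unfolding measurable_cong_sets[OF refl sets_uniform_count_measure_count_space] .
  then show ?thesis
    by (rule measurable_compose) simp
qed

lemma prefix_vertex_measurable [measurable]:
  "(\<lambda>\<xi>. prefix_vertex \<xi> k) \<in> measurable (boundary b) (count_space UNIV)"
proof (induction k)
  case 0
  then show ?case by (simp add: prefix_vertex_def)
next
  case (Suc k)
  note [measurable] = Suc coordinate_measurable[of "Suc k"]
  have "(\<lambda>\<xi>. prefix_vertex \<xi> k @ [\<xi> (Suc k)]) \<in> measurable (boundary b) (count_space UNIV)"
    by measurable
  then show ?case by (simp add: prefix_vertex_def)
qed

lemma branch_sum_measurable [measurable]: "branch_sum h \<in> borel_measurable (boundary b)"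
  unfolding branch_sum_def by measurable

text \<open>Level 0 is left out because fields vanish at the root and cannot be perturbed there.\<close>
definition cylinders :: "nat \<Rightarrow> (nat \<Rightarrow> nat) set set" where
  "cylinders b = {{\<xi> \<in> space (boundary b). prefix_vertex \<xi> k \<in> S} | k S. k \<ge> 1}"

lemma cylindersI: "k \<ge> 1 \<Longrightarrow> {\<xi> \<in> space (boundary b). prefix_vertex \<xi> k \<in> S} \<in> cylinders b"
  unfolding cylinders_def by blast

lemma algebra_cylinders: "algebra (space (boundary b)) (cylinders b)"
  unfolding algebra_iff_Un
proof (intro conjI ballI)
  show "cylinders b \<subseteq> Pow (space (boundary b))" by (auto simp: cylinders_def)
  show "{} \<in> cylinders b" using cylindersI[of 1 b "{}"] by simp
next
  fix X assume "X \<in> cylinders b"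
  then obtain k S where "k \<ge> 1" "X = {\<xi> \<in> space (boundary b). prefix_vertex \<xi> k \<in> S}"
    by (auto simp: cylinders_def)
  then have "space (boundary b) - X = {\<xi> \<in> space (boundary b). prefix_vertex \<xi> k \<in> - S}"
    by auto
  then show "space (boundary b) - X \<in> cylinders b"
    using cylindersI[OF \<open>k \<ge> 1\<close>] by (simp only:)
next
  fix X Y assume "X \<in> cylinders b" "Y \<in> cylinders b"
  then obtain k S l T where k: "k \<ge> 1"
      and X: "X = {\<xi> \<in> space (boundary b). prefix_vertex \<xi> k \<in> S}"
      and Y: "Y = {\<xi> \<in> space (boundary b). prefix_vertex \<xi> l \<in> T}"
    by (auto simp: cylinders_def)
  \<comment> \<open>Both cylinders are read off at the deeper of the two levels, where
    \<open>take\<close> recovers the shorter prefix.\<close>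
  have "X \<union> Y = {\<xi> \<in> space (boundary b).
      prefix_vertex \<xi> (max k l) \<in> {v. take k v \<in> S \<or> take l v \<in> T}}"
    by (auto simp: X Y take_prefix_vertex)
  moreover have "max k l \<ge> 1" using k by simp
  ultimately show "X \<union> Y \<in> cylinders b" by (simp only: cylindersI)
qed

text \<open>Coordinate \<open>i\<close> is the last entry of the prefix of length \<open>i\<close>,
  so the coordinate events generating the product \<sigma>-algebra are cylinders.\<close>

lemma sets_boundary: "sets (boundary b) = sigma_sets (space (boundary b)) (cylinders b)"
proof (rule antisym)
  have "sets (boundary b) = sigma_sets (space (boundary b))
      {{f \<in> space (boundary b). f i \<in> A} | i A. i \<in> {1..} \<and> A \<in> sets (uniform_count_measure {1..b})}"
    unfolding boundary_def by (simp add: sets_PiM_single space_PiM)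
  also have "\<dots> \<subseteq> sigma_sets (space (boundary b)) (cylinders b)"
  proof (intro sigma_sets_mono' subsetI)
    fix X assume "X \<in> {{f \<in> space (boundary b). f i \<in> A} | i A.
        i \<in> {1..} \<and> A \<in> sets (uniform_count_measure {1..b})}"
    then obtain i A where i: "i \<ge> 1" and X: "X = {f \<in> space (boundary b). f i \<in> A}" by auto
    have "X = {\<xi> \<in> space (boundary b). prefix_vertex \<xi> i \<in> {v. v ! (i - 1) \<in> A}}"
      using i by (simp add: X nth_prefix_vertex)
    then show "X \<in> cylinders b" using cylindersI[OF i] by (simp only:)
  qed
  finally show "sets (boundary b) \<subseteq> sigma_sets (space (boundary b)) (cylinders b)" .
  have "cylinders b \<subseteq> sets (boundary b)" by (auto simp: cylinders_def)
  then show "sigma_sets (space (boundary b)) (cylinders b) \<subseteq> sets (boundary b)"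
    by (rule sets.sigma_sets_subset)
qed

text \<open>Prescribing a prefix of length \<open>k\<close> prescribes \<open>k\<close> independent
  coordinates, each with probability \<open>1 / b\<close>.\<close>

lemma emeasure_cylinder:
  assumes "b > 0" "v \<in> level b k"
  shows "emeasure (boundary b) {\<xi> \<in> space (boundary b). prefix_vertex \<xi> k = v} = ennreal (1 / real b ^ k)"
proof -
  interpret product_prob_space "\<lambda>_ :: nat. uniform_count_measure {1..b}" "{1..}"
    using assms(1) by (intro product_prob_spaceI prob_space_uniform_count_measure) auto
  have v: "length v = k" "set v \<subseteq> {1..b}" using assms(2) by (auto simp: level_def tree_def)
  have vi: "v ! (i - 1) \<in> {1..b}" if "i \<in> {1..k}" for i
  proof -
    have "v ! (i - 1) \<in> set v" using that v(1) by (intro nth_mem) auto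
    then show ?thesis using v(2) by blast
  qed
  have "{\<xi> \<in> space (boundary b). prefix_vertex \<xi> k = v}
      = {\<xi> \<in> space (boundary b). \<forall>i\<in>{1..k}. \<xi> i \<in> {v ! (i - 1)}}"
  proof (intro Collect_cong conj_cong refl)
    fix \<xi>
    show "prefix_vertex \<xi> k = v \<longleftrightarrow> (\<forall>i\<in>{1..k}. \<xi> i \<in> {v ! (i - 1)})"
    proof -
      have "prefix_vertex \<xi> k = v \<longleftrightarrow> (\<forall>i<k. \<xi> (Suc i) = v ! i)"
        using v(1) by (simp add: list_eq_iff_nth_eq nth_prefix_vertex)
      also have "\<dots> \<longleftrightarrow> (\<forall>i\<in>Suc ` {..<k}. \<xi> i \<in> {v ! (i - 1)})"
        by auto
      also have "Suc ` {..<k} = {1..k}" by (simp add: image_Suc_lessThan)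
      finally show ?thesis .
    qed
  qed
  also have "emeasure (boundary b) \<dots> = (\<Prod>i\<in>{1..k}. emeasure (uniform_count_measure {1..b}) {v ! (i - 1)})"
    unfolding boundary_def using vi
    by (intro emeasure_PiM_Collect) (auto simp: sets_uniform_count_measure)
  also have "\<dots> = (\<Prod>i\<in>{1..k}. ennreal (1 / real b))"
  proof (intro prod.cong refl)
    fix i assume "i \<in> {1..k}"
    then have "{v ! (i - 1)} \<subseteq> {1..b}" using vi by blast
    from emeasure_uniform_count_measure[OF _ this]
    show "emeasure (uniform_count_measure {1..b}) {v ! (i - 1)} = ennreal (1 / real b)" by simp
  qed
  also have "\<dots> = ennreal (1 / real b ^ k)"
    by (simp add: ennreal_power power_one_over)
  finally show ?thesis .
qed

text \<open>Exactly one vertex of level \<open>k\<close> is a prefix of a given branch, so the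
  integrand is a sum over the level of values times cylinder indicators.\<close>

lemma nn_integral_prefix_vertex:
  assumes "b > 0" and nn: "\<And>v. 0 \<le> f v"
  shows "(\<integral>\<^sup>+\<xi>. ennreal (f (prefix_vertex \<xi> k)) \<partial>boundary b)
    = ennreal ((\<Sum>v\<in>level b k. f v) / real b ^ k)"
proof -
  let ?C = "\<lambda>v. {\<xi> \<in> space (boundary b). prefix_vertex \<xi> k = v}"
  have "(\<integral>\<^sup>+\<xi>. ennreal (f (prefix_vertex \<xi> k)) \<partial>boundary b)
      = (\<integral>\<^sup>+\<xi>. (\<Sum>v\<in>level b k. ennreal (f v) * indicator (?C v) \<xi>) \<partial>boundary b)"
  proof (rule nn_integral_cong)
    fix \<xi> assume \<xi>: "\<xi> \<in> space (boundary b)"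
    have "(\<Sum>v\<in>level b k. ennreal (f v) * indicator (?C v) \<xi>)
        = (\<Sum>v\<in>level b k. if v = prefix_vertex \<xi> k then ennreal (f v) else 0)"
      using \<xi> by (intro sum.cong) (auto simp: indicator_def)
    then show "ennreal (f (prefix_vertex \<xi> k)) = (\<Sum>v\<in>level b k. ennreal (f v) * indicator (?C v) \<xi>)"
      using prefix_vertex_in_level[OF \<xi>, of k] by simp
  qed
  also have "\<dots> = (\<Sum>v\<in>level b k. ennreal (f v) * ennreal (1 / real b ^ k))"
    using assms(1)
    by (subst nn_integral_sum) (auto intro!: sum.cong simp: nn_integral_cmult_indicator emeasure_cylinder)
  also have "\<dots> = ennreal (\<Sum>v\<in>level b k. f v * (1 / real b ^ k))"
    using nn by (simp add: ennreal_mult[symmetric] sum_ennreal)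
  finally show ?thesis by (simp add: sum_divide_distrib)
qed

text \<open>The sum of absolute values along a random branch has the norm of \<open>h\<close> as its
  expectation, so it is almost surely finite.\<close>

lemma AE_summable_branch:
  assumes "b > 0" "h \<in> fields b"
  shows "AE \<xi> in boundary b. summable (\<lambda>k. h (prefix_vertex \<xi> (Suc k)))"
proof -
  let ?c = "\<lambda>k. (\<Sum>v\<in>level b (Suc k). \<bar>h v\<bar>) / real b ^ Suc k"
  have "(\<integral>\<^sup>+\<xi>. (\<Sum>k. ennreal \<bar>h (prefix_vertex \<xi> (Suc k))\<bar>) \<partial>boundary b) = (\<Sum>k. ennreal (?c k))"
    using nn_integral_prefix_vertex[OF assms(1), of "\<lambda>v. \<bar>h v\<bar>"]
    by (subst nn_integral_suminf) auto
  also have "\<dots> = ennreal (\<Sum>k. ?c k)"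
    using assms(2) by (intro suminf_ennreal2) (auto simp: fields_def intro!: divide_nonneg_nonneg sum_nonneg)
  finally have "(\<integral>\<^sup>+\<xi>. (\<Sum>k. ennreal \<bar>h (prefix_vertex \<xi> (Suc k))\<bar>) \<partial>boundary b) \<noteq> \<infinity>"
    by simp
  then have "AE \<xi> in boundary b. (\<Sum>k. ennreal \<bar>h (prefix_vertex \<xi> (Suc k))\<bar>) \<noteq> \<infinity>"
    by (intro nn_integral_PInf_AE) auto
  then show ?thesis
    by eventually_elim (rule summable_rabs_cancel, rule summable_suminf_not_top, auto)
qed

section \<open>Scaling fields\<close>

lemma borel_measurable_gA:
  assumes "finite (frontier A)"
  shows "gA A \<in> borel_measurable borel"
  using isCont_gA[OF assms] by (intro borel_measurable_continuous_onI continuous_at_imp_continuous_on) auto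

lemma integrable_gA:
  assumes "b > 0" "finite (frontier A)" and [measurable]: "X \<in> borel_measurable (boundary b)"
  shows "integrable (boundary b) (\<lambda>\<xi>. gA A (X \<xi>))"
proof -
  interpret prob_space "boundary b" using assms(1) by (rule prob_space_boundary)
  note [measurable] = borel_measurable_gA[OF assms(2)]
  show ?thesis by (rule integrable_const_bound[of _ 1]) (auto simp: gA_bounds)
qed

lemma scale_in_fields:
  assumes "h \<in> fields b"
  shows "(\<lambda>v. t * h v) \<in> fields b"
proof -
  have "summable (\<lambda>k. \<bar>t\<bar> * ((\<Sum>v\<in>level b (Suc k). \<bar>h v\<bar>) / real b ^ Suc k))"
    using assms by (intro summable_mult) (simp add: fields_def)
  then show ?thesis
    using assms by (simp add: fields_def abs_mult sum_distrib_left)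
qed

text \<open>Where the branch series converges, the factor \<open>t\<close> comes out of it.
  Continuity of \<open>gA A\<close> and dominated convergence do the rest.\<close>

lemma isCont_PsiA_scale:
  assumes "b > 0" "finite (frontier A)" "h \<in> fields b"
  shows "isCont (\<lambda>t. PsiA b A (\<lambda>v. t * h v)) t"
proof -
  interpret prob_space "boundary b" using assms(1) by (rule prob_space_boundary)
  note [measurable] = borel_measurable_gA[OF assms(2)]
  have "(\<lambda>n. PsiA b A (\<lambda>v. X n * h v)) \<longlonglongrightarrow> PsiA b A (\<lambda>v. t * h v)" if X: "X \<longlonglongrightarrow> t" for X
    unfolding PsiA_def
  proof (rule integral_dominated_convergence[where w="\<lambda>_. 1"])
    show "AE \<xi> in boundary b. (\<lambda>n. gA A (branch_sum (\<lambda>v. X n * h v) \<xi>))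
        \<longlonglongrightarrow> gA A (branch_sum (\<lambda>v. t * h v) \<xi>)"
      using AE_summable_branch[OF assms(1,3)]
    proof eventually_elim
      case (elim \<xi>)
      have "branch_sum (\<lambda>v. s * h v) \<xi> = s * branch_sum h \<xi>" for s
        unfolding branch_sum_def by (rule suminf_mult[OF elim])
      then show ?case
        by (auto intro!: isCont_tendsto_compose[OF isCont_gA[OF assms(2)]] tendsto_intros X)
    qed
  qed (auto simp: gA_bounds)
  then show ?thesis
    by (auto simp: continuous_at_sequentially o_def)
qed

lemma cost_scale_le:
  assumes "0 \<le> t" "t \<le> 1" "\<alpha> > 0"
  shows "cost b \<alpha> lam (\<lambda>v. t * h v) \<le> cost b \<alpha> lam h"
proof -
  have "\<bar>t * x\<bar> powr \<alpha> \<le> \<bar>x\<bar> powr \<alpha>" for x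
    using assms by (intro powr_mono2) (auto simp: abs_mult mult_left_le_one_le)
  then show ?thesis
    unfolding cost_def
    by (intro mult_left_mono infsum_mono nonneg_summable_on_complete ennreal_leI) auto
qed

text \<open>Each competitor for \<open>q'\<close> can be scaled down to a competitor for
  \<open>q\<close> by the intermediate value theorem, at no greater cost.\<close>

lemma QA_mono:
  assumes "b > 0" "\<alpha> > 0" "finite (frontier A)" "measure gauss A \<le> q" "q \<le> q'"
  shows "QA b \<alpha> lam A q \<le> QA b \<alpha> lam A q'"
  unfolding QA_def[of _ _ _ _ q']
proof (rule Inf_greatest, safe)
  fix h assume h: "h \<in> fields b" and q': "q' = PsiA b A h"
  \<comment> \<open>The scale 0 supplies the lower end for the intermediate value theorem; the scale
    1 gives \<open>q'\<close>.\<close>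
  have "PsiA b A (\<lambda>v. 0 * h v) = measure gauss A"
    using prob_space.prob_space[OF prob_space_boundary[OF assms(1)]]
    by (simp add: PsiA_def branch_sum_def gA_0)
  then have "\<exists>t\<ge>0. t \<le> 1 \<and> PsiA b A (\<lambda>v. t * h v) = q"
    using assms q' isCont_PsiA_scale[OF assms(1,3) h] by (intro IVT) auto
  then obtain t where t: "0 \<le> t" "t \<le> 1" "PsiA b A (\<lambda>v. t * h v) = q" by auto
  have "QA b \<alpha> lam A q \<le> cost b \<alpha> lam (\<lambda>v. t * h v)"
    unfolding QA_def using t scale_in_fields[OF h] by (intro Inf_lower) blast
  also have "\<dots> \<le> cost b \<alpha> lam h" using cost_scale_le t assms(2) by blast
  finally show "QA b \<alpha> lam A q \<le> cost b \<alpha> lam h" .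
qed

section \<open>Perturbing a field at one vertex\<close>

lemma bump_in_fields:
  assumes h: "h \<in> fields b" and v: "v \<noteq> []"
  shows "h(v := y) \<in> fields b"
proof -
  have "\<forall>\<^sub>F k in sequentially. (\<Sum>w\<in>level b (Suc k). \<bar>(h(v := y)) w\<bar>) / real b ^ Suc k
      = (\<Sum>w\<in>level b (Suc k). \<bar>h w\<bar>) / real b ^ Suc k"
    \<comment> \<open>For \<open>k \<ge> length v\<close>, level \<open>Suc k\<close> lies strictly
      below \<open>v\<close> in the tree and does not see the change.\<close>
    using eventually_ge_at_top[of "length v"]
  proof eventually_elim
    case (elim k)
    then show ?case by (intro arg_cong2[where f="(/)"] sum.cong refl) (auto simp: level_def)
  qed
  from summable_cong[OF this] show ?thesis
    using h v by (simp add: fields_def del: fun_upd_apply) simp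
qed

lemma branch_sum_bump:
  assumes "summable (\<lambda>k. h (prefix_vertex \<xi> (Suc k)))" "v \<noteq> []"
  shows "branch_sum (h(v := h v + s)) \<xi>
    = branch_sum h \<xi> + (if prefix_vertex \<xi> (length v) = v then s else 0)"
proof -
  define d where "d = (if prefix_vertex \<xi> (length v) = v then s else 0)"
  \<comment> \<open>The series starts at level 1, so \<open>v\<close> can only occur at index
    \<open>length v - 1\<close>, which is a true predecessor because \<open>v\<close> is not the
    root.\<close>
  have "(h(v := h v + s)) (prefix_vertex \<xi> (Suc k))
      = h (prefix_vertex \<xi> (Suc k)) + (if k = length v - 1 then d else 0)" for k
  proof (cases "prefix_vertex \<xi> (Suc k) = v")
    case True
    then have "length v = Suc k" by auto
    with True show ?thesis by (simp add: d_def)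
  next
    case False
    then show ?thesis using assms(2) by (auto simp: d_def)
  qed
  moreover have "(\<lambda>k. if k = length v - 1 then d else 0) sums d"
    using sums_single[of "length v - 1" "\<lambda>_. d"] by simp
  ultimately have "(\<lambda>k. (h(v := h v + s)) (prefix_vertex \<xi> (Suc k))) sums (branch_sum h \<xi> + d)"
    unfolding branch_sum_def using assms(1) by (simp only: sums_add summable_sums)
  then show ?thesis by (simp only: branch_sum_def[of "h(v := h v + s)"] sums_iff d_def)
qed

text \<open>Only branches through \<open>v\<close> have their sum shifted, so the change of \<Psi>
  is an integral over the cylinder of \<open>v\<close>.\<close>

lemma PsiA_bump:
  assumes "b > 0" "finite (frontier A)" "h \<in> fields b" "v \<noteq> []"
  shows "PsiA b A (h(v := h v + s)) = PsiA b A h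
    + (\<integral>\<xi>. indicator {\<xi> \<in> space (boundary b). prefix_vertex \<xi> (length v) = v} \<xi>
          * (gA A (branch_sum h \<xi> + s) - gA A (branch_sum h \<xi>)) \<partial>boundary b)"
    (is "_ = _ + (\<integral>\<xi>. indicator ?C \<xi> * ?f \<xi> \<partial>boundary b)")
proof -
  note [measurable] = borel_measurable_gA[OF assms(2)]
  have "PsiA b A (h(v := h v + s)) = (\<integral>\<xi>. gA A (branch_sum h \<xi>) + indicator ?C \<xi> * ?f \<xi> \<partial>boundary b)"
    unfolding PsiA_def
  proof (rule integral_cong_AE)
    show "AE \<xi> in boundary b. gA A (branch_sum (h(v := h v + s)) \<xi>)
        = gA A (branch_sum h \<xi>) + indicator ?C \<xi> * ?f \<xi>"
      using AE_summable_branch[OF assms(1,3)] AE_space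
      by eventually_elim (simp add: branch_sum_bump[OF _ assms(4)] indicator_def del: fun_upd_apply)
  qed measurable
  also have "\<dots> = PsiA b A h + (\<integral>\<xi>. indicator ?C \<xi> * ?f \<xi> \<partial>boundary b)"
    unfolding PsiA_def
  proof (rule Bochner_Integration.integral_add)
    have "integrable (boundary b) ?f"
      by (intro Bochner_Integration.integrable_diff integrable_gA assms) measurable
    moreover have "?C \<in> sets (boundary b)" by measurable
    ultimately show "integrable (boundary b) (\<lambda>\<xi>. indicator ?C \<xi> * ?f \<xi>)"
      using integrable_mult_indicator[of ?C "boundary b" ?f] by simp
  qed (intro integrable_gA assms; measurable)
  finally show ?thesis .
qed

lemma cost_bump_le:
  assumes "\<bar>h v + s\<bar> powr \<alpha> \<le> \<bar>h v\<bar> powr \<alpha> + e" "e \<ge> 0"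
  shows "cost b \<alpha> lam (h(v := h v + s)) \<le> cost b \<alpha> lam h + ennreal lam * ennreal e"
proof -
  let ?T = "tree b - {[]}"
  let ?d = "\<lambda>w. if w = v then ennreal e else 0"
  have sm: "f summable_on ?T" for f :: "nat list \<Rightarrow> ennreal"
    by (rule nonneg_summable_on_complete) simp
  \<comment> \<open>The extra cost \<open>e\<close> is counted at most once: not at all if
    \<open>v\<close> lies outside \<open>?T\<close>.\<close>
  have "infsum ?d ?T \<le> infsum ?d {v}"
    by (rule infsum_mono_neutral) (auto intro: nonneg_summable_on_complete)
  then have d: "infsum ?d ?T \<le> ennreal e" by simp
  have "(\<Sum>\<^sub>\<infinity>w\<in>?T. ennreal (\<bar>(h(v := h v + s)) w\<bar> powr \<alpha>))
      \<le> (\<Sum>\<^sub>\<infinity>w\<in>?T. ennreal (\<bar>h w\<bar> powr \<alpha>) + ?d w)"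
    using assms by (intro infsum_mono sm) (auto simp flip: ennreal_plus intro!: ennreal_leI)
  also have "\<dots> \<le> (\<Sum>\<^sub>\<infinity>w\<in>?T. ennreal (\<bar>h w\<bar> powr \<alpha>)) + ennreal e"
    unfolding infsum_add[OF sm sm] by (intro add_left_mono d)
  finally show ?thesis
    unfolding cost_def distrib_left[symmetric] by (rule mult_left_mono) simp
qed

text \<open>Finite cost bounds all values of \<open>h\<close> on nonroot vertices by one
  \<open>R\<close>, and \<open>|x|^\<alpha>\<close> is uniformly continuous on a compact interval.
  Hence one \<delta> serves all these vertices, however deep.\<close>

lemma uniform_bump_size:
  assumes "cost b \<alpha> lam h < \<infinity>" "\<alpha> > 0" "lam > 0" "e > 0"
  shows "\<exists>\<delta>>0. \<forall>v\<in>tree b - {[]}. \<forall>s. \<bar>s\<bar> < \<delta> \<longrightarrow> \<bar>h v + s\<bar> powr \<alpha> \<le> \<bar>h v\<bar> powr \<alpha> + e"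
proof -
  define K where "K = enn2real (cost b \<alpha> lam h)"
  have K: "cost b \<alpha> lam h = ennreal K" using assms(1) by (simp add: K_def)
  have "K \<ge> 0" by (simp add: K_def)
  \<comment> \<open>A single summand of the cost, \<open>lam * |h v|^\<alpha>\<close>, is at most
    \<open>K\<close>; solving for \<open>|h v|\<close> gives \<open>R\<close>.\<close>
  define R where "R = (K / lam) powr (1 / \<alpha>)"
  have R: "\<bar>h v\<bar> \<le> R" if v: "v \<in> tree b - {[]}" for v
  proof -
    have "infsum (\<lambda>v. ennreal (\<bar>h v\<bar> powr \<alpha>)) {v} \<le> infsum (\<lambda>v. ennreal (\<bar>h v\<bar> powr \<alpha>)) (tree b - {[]})"
      using v by (intro infsum_mono_neutral) (auto intro: nonneg_summable_on_complete)
    then have "ennreal lam * ennreal (\<bar>h v\<bar> powr \<alpha>) \<le> cost b \<alpha> lam h"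
      unfolding cost_def by (intro mult_left_mono) auto
    then have "lam * \<bar>h v\<bar> powr \<alpha> \<le> K"
      using \<open>K \<ge> 0\<close> assms(3) by (simp add: K flip: ennreal_mult)
    then have "\<bar>h v\<bar> powr \<alpha> \<le> K / lam" using assms(3) by (simp add: field_simps)
    then have "(\<bar>h v\<bar> powr \<alpha>) powr (1 / \<alpha>) \<le> R"
      unfolding R_def using assms(2) by (intro powr_mono2) auto
    then show ?thesis using assms(2) by (simp add: powr_powr)
  qed
  \<comment> \<open>The margin 1 leaves room for \<open>h v + s\<close> when
    \<open>|s| < 1\<close>.\<close>
  have "continuous_on {-(R+1)..R+1} (\<lambda>x. \<bar>x\<bar> powr \<alpha>)"
    using assms(2) by (intro continuous_on_powr' continuous_intros) auto
  then have "uniformly_continuous_on {-(R+1)..R+1} (\<lambda>x. \<bar>x\<bar> powr \<alpha>)"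
    by (rule compact_uniformly_continuous) simp
  then obtain d where d: "d > 0" "\<And>x y. x \<in> {-(R+1)..R+1} \<Longrightarrow> y \<in> {-(R+1)..R+1} \<Longrightarrow> \<bar>y - x\<bar> < d \<Longrightarrow>
      \<bar>\<bar>y\<bar> powr \<alpha> - \<bar>x\<bar> powr \<alpha>\<bar> < e"
    using assms(4) unfolding uniformly_continuous_on_def dist_real_def by meson
  have "\<bar>h v + s\<bar> powr \<alpha> \<le> \<bar>h v\<bar> powr \<alpha> + e" if "v \<in> tree b - {[]}" "\<bar>s\<bar> < min d 1" for v s
    using R[OF that(1)] that(2) d(2)[of "h v" "h v + s"] by (auto simp: abs_le_iff abs_less_iff)
  then show ?thesis using d(1) by (intro exI[of _ "min d 1"]) auto
qed

text \<open>Rational shifts are enough, so only countably many null sets have to be discarded.\<close>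
lemma local_maximizer_if_rational_shifts:
  fixes f :: "real \<Rightarrow> real"
  assumes cont: "\<And>y. isCont f y" and "\<delta> > 0"
    and le: "\<And>r :: rat. \<bar>of_rat r :: real\<bar> < \<delta> \<Longrightarrow> f (x + of_rat r) \<le> f x"
  shows "local_maximizer f x"
proof -
  have "f y \<le> f x" if y: "\<bar>y - x\<bar> < \<delta>" for y
  proof (rule ccontr)
    assume "\<not> f y \<le> f x"
    then have "\<forall>\<^sub>F z in at y. f x < f z"
      using cont[of y] by (intro order_tendstoD(1)[of f "f y"]) (auto simp: isCont_def)
    then obtain e where e: "e > 0" "\<And>z. z \<noteq> y \<Longrightarrow> \<bar>z - y\<bar> < e \<Longrightarrow> f x < f z"
      by (auto simp: eventually_at dist_real_def)
    \<comment> \<open>The bound \<open>e\<close> puts \<open>x + r\<close> in the neighbourhood of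
      \<open>y\<close> where \<open>f\<close> exceeds \<open>f x\<close>, and the other bound keeps
      \<open>|r| < \<delta>\<close>.\<close>
    obtain r :: rat where r: "y - x < of_rat r" "of_rat r < y - x + min e (\<delta> - \<bar>y - x\<bar>)"
      using of_rat_dense[of "y - x" "y - x + min e (\<delta> - \<bar>y - x\<bar>)"] e y by auto
    have "f x < f (x + of_rat r)" using r by (intro e(2)) auto
    moreover have "\<bar>of_rat r :: real\<bar> < \<delta>" using r y by linarith
    ultimately show False using le[of r] by simp
  qed
  then show ?thesis
    unfolding local_maximizer_def eventually_nhds_metric dist_real_def using assms(2) by blast
qed

text \<open>If no field of cost below \<open>c\<close> has larger \<Psi>, then no cheap bump at any
  vertex helps, and almost every branch sum is a maximizer of \<open>gA A\<close>.\<close>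

lemma exists_improving_bump:
  assumes "b > 0" "\<alpha> > 0" "lam > 0" and fin: "finite (frontier A)"
    and loc: "\<And>x. local_maximizer (gA A) x \<Longrightarrow> global_maximizer (gA A) x"
    and h: "h \<in> fields b" and less: "PsiA b A h < MA A" and c: "cost b \<alpha> lam h < c"
  shows "\<exists>h'\<in>fields b. PsiA b A h < PsiA b A h' \<and> cost b \<alpha> lam h' < c"
proof (rule ccontr)
  assume no: "\<not> ?thesis"
  interpret prob_space "boundary b" using assms(1) by (rule prob_space_boundary)
  note [measurable] = borel_measurable_gA[OF fin]
  have "cost b \<alpha> lam h < \<infinity>" using c by (metis infinity_ennreal_def less_top order_less_le_trans top_greatest)
  \<comment> \<open>The intermediate \<open>c'\<close> is finite even if \<open>c\<close> is
    infinite, so the allowance \<open>e\<close> with \<open>lam * e = c' - cost\<close> is a real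
    number; \<open>c' < c\<close> keeps the final bound strict.\<close>
  obtain c' where c': "cost b \<alpha> lam h < c'" "c' < c" using dense[OF c] by auto
  define e where "e = enn2real (c' - cost b \<alpha> lam h) / lam"
  have fin_c': "c' < top" using c'(2) by (metis order_less_le_trans top_greatest)
  have "c' - cost b \<alpha> lam h > 0" using c'(1) by (simp add: diff_gr0_ennreal)
  moreover have "c' - cost b \<alpha> lam h < top" using fin_c' by (meson diff_le_self_ennreal order_le_less_trans)
  ultimately have e: "e > 0" "ennreal lam * ennreal e = c' - cost b \<alpha> lam h"
    using assms(3) by (auto simp: e_def enn2real_positive_iff simp flip: ennreal_mult)
  have cost_e: "cost b \<alpha> lam h + ennreal lam * ennreal e < c"
    using c' unfolding e(2) by (simp add: add_diff_inverse_ennreal less_imp_le)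
  obtain \<delta> where \<delta>: "\<delta> > 0"
    "\<And>v s. v \<in> tree b - {[]} \<Longrightarrow> \<bar>s\<bar> < \<delta> \<Longrightarrow> \<bar>h v + s\<bar> powr \<alpha> \<le> \<bar>h v\<bar> powr \<alpha> + e"
    using uniform_bump_size[OF \<open>cost b \<alpha> lam h < \<infinity>\<close> assms(2,3) e(1)] by blast
  have shift: "AE \<xi> in boundary b. gA A (branch_sum h \<xi> + s) \<le> gA A (branch_sum h \<xi>)" if s: "\<bar>s\<bar> < \<delta>" for s
  proof -
    define f where "f \<xi> = gA A (branch_sum h \<xi> + s) - gA A (branch_sum h \<xi>)" for \<xi>
    have [measurable]: "f \<in> borel_measurable (boundary b)" unfolding f_def by measurable
    have bd: "\<bar>f \<xi>\<bar> \<le> 1" for \<xi>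
      using gA_bounds[of A] by (auto simp: f_def abs_le_iff) (smt (verit))+
    let ?C = "\<lambda>v. {\<xi> \<in> space (boundary b). prefix_vertex \<xi> (length v) = v}"
    \<comment> \<open>The bump by \<open>s\<close> at \<open>v\<close> still costs less than
      \<open>c\<close>, so by assumption it does not raise \<Psi>, and this integral is exactly the
      change.\<close>
    have vertex: "(\<integral>\<xi>. indicator (?C v) \<xi> * f \<xi> \<partial>boundary b) \<le> 0" if v: "v \<in> tree b" "v \<noteq> []" for v
    proof -
      have "cost b \<alpha> lam (h(v := h v + s)) < c"
        using cost_bump_le[of h v s \<alpha> e b lam] \<delta>(2)[of v s] v s e(1) cost_e
        by (meson DiffI empty_iff insert_iff less_imp_le order_le_less_trans)
      then have "PsiA b A (h(v := h v + s)) \<le> PsiA b A h"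
        using no bump_in_fields[OF h v(2)] by (meson not_less)
      then show ?thesis
        unfolding PsiA_bump[OF assms(1) fin h v(2)] f_def by simp
    qed
    have "AE \<xi> in boundary b. f \<xi> \<le> 0"
    proof (rule AE_nonpos_if_integrals_over_algebra_nonpos[OF algebra_cylinders sets_boundary _ bd])
      fix C assume "C \<in> cylinders b"
      then obtain k S where k: "k \<ge> 1" and C: "C = {\<xi> \<in> space (boundary b). prefix_vertex \<xi> k \<in> S}"
        by (auto simp: cylinders_def)
      \<comment> \<open>A cylinder at level \<open>k\<close> is the disjoint union of the cylinders
        of its finitely many vertices, none of which is the root as
        \<open>k \<ge> 1\<close>.\<close>
      have "(\<integral>\<xi>. indicator C \<xi> * f \<xi> \<partial>boundary b)
          = (\<integral>\<xi>. (\<Sum>v\<in>level b k \<inter> S. indicator (?C v) \<xi> * f \<xi>) \<partial>boundary b)"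
      proof (rule Bochner_Integration.integral_cong[OF refl])
        fix \<xi> assume \<xi>: "\<xi> \<in> space (boundary b)"
        have "(\<Sum>v\<in>level b k \<inter> S. indicator (?C v) \<xi> * f \<xi>)
            = (\<Sum>v\<in>level b k \<inter> S. if v = prefix_vertex \<xi> k then f \<xi> else 0)"
          using \<xi> by (intro sum.cong) (auto simp: indicator_def level_def)
        then show "indicator C \<xi> * f \<xi> = (\<Sum>v\<in>level b k \<inter> S. indicator (?C v) \<xi> * f \<xi>)"
          using \<xi> prefix_vertex_in_level[OF \<xi>, of k] by (simp add: C indicator_def)
      qed
      also have "\<dots> = (\<Sum>v\<in>level b k \<inter> S. \<integral>\<xi>. indicator (?C v) \<xi> * f \<xi> \<partial>boundary b)"
        using bd by (intro Bochner_Integration.integral_sum integrable_const_bound[of _ 1])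
          (auto simp: indicator_def)
      also have "\<dots> \<le> 0"
        using k by (intro sum_nonpos vertex) (auto simp: level_def)
      finally show "(\<integral>\<xi>. indicator C \<xi> * f \<xi> \<partial>boundary b) \<le> 0" .
    qed simp
    then show ?thesis by (simp add: f_def)
  qed
  have "AE \<xi> in boundary b. \<forall>r :: rat. \<bar>of_rat r :: real\<bar> < \<delta> \<longrightarrow>
      gA A (branch_sum h \<xi> + of_rat r) \<le> gA A (branch_sum h \<xi>)"
    unfolding AE_all_countable
  proof
    fix r :: rat
    show "AE \<xi> in boundary b. \<bar>of_rat r :: real\<bar> < \<delta> \<longrightarrow>
        gA A (branch_sum h \<xi> + of_rat r) \<le> gA A (branch_sum h \<xi>)"
      using shift[of "of_rat r"] by (cases "\<bar>of_rat r :: real\<bar> < \<delta>") auto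
  qed
  then have "AE \<xi> in boundary b. gA A (branch_sum h \<xi>) = MA A"
  proof eventually_elim
    case (elim \<xi>)
    then have "global_maximizer (gA A) (branch_sum h \<xi>)"
      using \<delta>(1) isCont_gA[OF fin] by (intro loc local_maximizer_if_rational_shifts[of _ \<delta>]) auto
    then show ?case
      unfolding MA_def global_maximizer_def by (intro cSup_eq_maximum[symmetric]) auto
  qed
  \<comment> \<open>Total mass one turns this integral into \<open>MA A\<close>, against
    \<open>PsiA b A h < MA A\<close>.\<close>
  then have "PsiA b A h = (\<integral>\<xi>. MA A \<partial>boundary b)"
    unfolding PsiA_def by (intro integral_cong_AE) auto
  then show False using less prob_space by simp
qed

section \<open>Right-continuity of the minimal cost\<close>

theorem proposition4p2:
  fixes b r :: nat and \<alpha> lam q :: real and A :: "real set"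
  assumes "b \<ge> 2" and "\<alpha> > 0" and "lam > 0"
    and "A \<noteq> {}" and "A \<noteq> UNIV"
    and "r \<ge> 1" and "disjoint_interval_union r A"
    and "\<And>x. local_maximizer (gA A) x \<Longrightarrow> global_maximizer (gA A) x"
    and "measure gauss A < q" and "q < MA A"
  shows "(QA b \<alpha> lam A \<longlongrightarrow> QA b \<alpha> lam A q) (at_right q)"
proof (rule order_tendstoI)
  have b: "b > 0" using assms(1) by simp
  have fin: "finite (frontier A)"
    using assms(7) by (rule finite_frontier_disjoint_interval_union)
  note mono = QA_mono[OF b assms(2) fin]
  {
    \<comment> \<open>The lower bound is monotonicity alone.\<close>
    fix c assume "c < QA b \<alpha> lam A q"
    then have "c < QA b \<alpha> lam A q'" if "q < q'" for q'
      using mono[of q q'] that assms(9) by (auto intro: less_le_trans)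
    then show "\<forall>\<^sub>F q' in at_right q. c < QA b \<alpha> lam A q'"
      by (auto simp: eventually_at_right_field intro!: exI[of _ "q + 1"])
  next
    \<comment> \<open>A near-optimal field for \<open>q\<close> is improved to some
      \<open>h'\<close> beyond \<open>q\<close> with cost still below \<open>c\<close>; monotonicity
      then bounds \<open>QA\<close> on the whole interval between \<open>q\<close> and
      \<open>PsiA b A h'\<close>.\<close>
    fix c assume "QA b \<alpha> lam A q < c"
    then obtain h where h: "h \<in> fields b" "PsiA b A h = q" "cost b \<alpha> lam h < c"
      unfolding QA_def Inf_less_iff by blast
    then obtain h' where h': "h' \<in> fields b" "q < PsiA b A h'" "cost b \<alpha> lam h' < c"
      using exists_improving_bump[OF b assms(2,3) fin assms(8), of h c] assms(10) by auto
    have "QA b \<alpha> lam A q' < c" if "q < q'" "q' < PsiA b A h'" for q'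
    proof -
      have "QA b \<alpha> lam A q' \<le> QA b \<alpha> lam A (PsiA b A h')"
        using mono[of q' "PsiA b A h'"] that assms(9) by simp
      also have "\<dots> \<le> cost b \<alpha> lam h'"
        unfolding QA_def using h'(1) by (intro Inf_lower) blast
      finally show ?thesis using h'(3) by simp
    qed
    then show "\<forall>\<^sub>F q' in at_right q. QA b \<alpha> lam A q' < c"
      using h'(2) by (auto simp: eventually_at_right_field)
  }
qed

end
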